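(* For each $n\ge 1$ let $G_n$ be a finite abelian group of order $n$, and let $h=h(n)$ be an integer-valued function of $n$ satisfying $4\le h(n)\le \lfloor n/2\rfloor+1$. For $a\in G_n$ let $f_a(h)=|\mathcal{F}_a(h)|$, where $\mathcal{F}_a(h)$ is the family of all $h$-element subsets $\{x_1,\dots,x_h\}$ of $G_n$ (with $x_1,\dots,x_h$ distinct) such that $x_1+\cdots+x_h=a$. Then \[ \lim_{n\to\infty}\frac{\min_{a\in G_n} f_a(h(n))}{\max_{a\in G_n} f_a(h(n))}=1 . \]
   Context: $G_n$ is an arbitrary finite abelian group of order $n$ (written additively); the conclusion is claimed for every choice of such groups and every such function $h$. *)

theory Defs
  imports Complex_Main "HOL-Algebra.Coset" "HOL-Algebra.FiniteProduct"
begin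

text \<open>
  Abelian groups are the \<^locale>\<open>comm_group\<close>s of HOL-Algebra, so the group operation is written
  multiplicatively and \<^const>\<open>finprod\<close> plays the role of the sum \<open>x\<^sub>1 + \<cdots> + x\<^sub>h\<close>.
\<close>

definition sum_subsets :: "('a, 'b) monoid_scheme \<Rightarrow> nat \<Rightarrow> 'a \<Rightarrow> 'a set set" where
  "sum_subsets G h a =
     {X. X \<subseteq> carrier G \<and> finite X \<and> card X = h \<and> finprod G (\<lambda>x. x) X = a}"

definition num_sum_subsets :: "('a, 'b) monoid_scheme \<Rightarrow> nat \<Rightarrow> 'a \<Rightarrow> nat" where
  "num_sum_subsets G h a = card (sum_subsets G h a)"

end

theory Submission imports Defs "HOL-Real_Asymp.Real_Asymp"
begin

text \<open>
  Write \<open>f\<^sub>k(a)\<close> for the number of \<open>k\<close>-subsets with product \<open>a\<close>. Newton's identity between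
  elementary symmetric functions and power sums, read in the group ring, expresses \<open>k f\<^sub>k(a)\<close> as
  the alternating sum over \<open>1 \<le> j \<le> k\<close> of \<open>\<Sum>\<^sub>x f\<^bsub>k-j\<^esub>(a / x\<^sup>j)\<close>. The term for \<open>j = 1\<close> does not
  depend on \<open>a\<close>, so the oscillation of \<open>f\<^sub>k\<close> is at most the number \<open>E\<^sub>k\<close> determined by
  \<open>E\<^sub>0 = 1\<close>, \<open>E\<^sub>1 = 0\<close> and \<open>k E\<^sub>k = n (E\<^sub>0 + \<cdots> + E\<^bsub>k-2\<^esub>)\<close>, whose generating function is
  \<open>((1 - y) e\<^sup>y)\<close> to the power \<open>-n\<close>. As the average of \<open>f\<^sub>h\<close> is \<open>(n choose h) / n\<close>, it suffices
  that \<open>n E\<^sub>h / (n choose h)\<close> tends to \<open>0\<close>. For \<open>h \<le> n/4\<close> the recurrence gives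
  \<open>E\<^sub>h = O((n choose h) / n\<^sup>2)\<close> by induction. For larger \<open>h\<close>, evaluating the generating function
  at \<open>y = h/n\<close> and comparing with the mode of the binomial distribution with parameter \<open>h/n\<close> gives
  \<open>E\<^sub>h ((1 - h/n) e)\<^sup>h \<le> (n + 1) (n choose h)\<close>, and \<open>(1 - h/n) e\<close> exceeds \<open>6/5\<close> because
  \<open>h/n\<close> is at most about \<open>1/2\<close>.
\<close>

section \<open>Newton's identity by double counting\<close>

text \<open>With the group elements substituted for the variables in the group ring, the cardinality
  for \<open>j\<close> at least 2 is the coefficient at \<open>a\<close> of the monomial symmetric
  polynomial with exponents \<open>j, 1, ..., 1\<close> (\<open>k\<close> ones).\<close>

definition marked_subsets :: "('a, 'b) monoid_scheme \<Rightarrow> nat \<Rightarrow> nat \<Rightarrow> 'a \<Rightarrow> ('a \<times> 'a set) set" where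
  "marked_subsets G j k a = {(x, X). x \<in> carrier G \<and> X \<subseteq> carrier G \<and> finite X \<and> card X = k \<and>
     x \<notin> X \<and> x [^]\<^bsub>G\<^esub> j \<otimes>\<^bsub>G\<^esub> finprod G (\<lambda>x. x) X = a}"

context comm_group
begin

lemma finite_sum_subsets: "finite (carrier G) \<Longrightarrow> finite (sum_subsets G k a)"
  by (rule finite_subset[of _ "Pow (carrier G)"]) (auto simp: sum_subsets_def)

lemma finite_marked_subsets: "finite (carrier G) \<Longrightarrow> finite (marked_subsets G j k a)"
  by (rule finite_subset[of _ "carrier G \<times> Pow (carrier G)"]) (auto simp: marked_subsets_def)

text \<open>Taking \<open>x\<close> out of \<open>X\<close> moves its factor from the product to the
  power, so the exponent rises by one and the size drops by one.\<close>

lemma card_pointed_subsets: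
  "card {(x, X). x \<in> X \<and> X \<subseteq> carrier G \<and> finite X \<and> card X = Suc k \<and>
           x [^] j \<otimes> finprod G (\<lambda>x. x) X = a} = card (marked_subsets G (Suc j) k a)"
    (is "card ?Q = _")
proof -
  have prod: "x [^] j \<otimes> finprod G (\<lambda>x. x) (insert x Y) = x [^] Suc j \<otimes> finprod G (\<lambda>x. x) Y"
    if "x \<in> carrier G" "Y \<subseteq> carrier G" "finite Y" "x \<notin> Y" for x Y
  proof -
    have "finprod G (\<lambda>x. x) (insert x Y) = x \<otimes> finprod G (\<lambda>x. x) Y"
      using that by (intro finprod_insert) auto
    moreover have "finprod G (\<lambda>x. x) Y \<in> carrier G"
      using that by (intro finprod_closed) auto
    ultimately show ?thesis using that by (simp add: m_assoc)
  qed
  have "bij_betw (\<lambda>(x, Y). (x, insert x Y)) (marked_subsets G (Suc j) k a) ?Q"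
  proof (rule bij_betw_byWitness[where f' = "\<lambda>(x, X). (x, X - {x})"])
    show "(\<lambda>(x, Y). (x, insert x Y)) ` marked_subsets G (Suc j) k a \<subseteq> ?Q"
      using prod by (auto simp: marked_subsets_def)
    show "(\<lambda>(x, X). (x, X - {x})) ` ?Q \<subseteq> marked_subsets G (Suc j) k a"
    proof clarify
      fix x X assume *: "x \<in> X" "X \<subseteq> carrier G" "finite X" "card X = Suc k"
        "a = x [^] j \<otimes> finprod G (\<lambda>x. x) X"
      have "x [^] j \<otimes> finprod G (\<lambda>x. x) (insert x (X - {x}))
          = x [^] Suc j \<otimes> finprod G (\<lambda>x. x) (X - {x})"
        using * by (intro prod) auto
      thus "(x, X - {x}) \<in> marked_subsets G (Suc j) k (x [^] j \<otimes> finprod G (\<lambda>x. x) X)"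
        using * by (auto simp: marked_subsets_def insert_absorb)
    qed
  qed (auto simp: marked_subsets_def)
  thus ?thesis by (simp add: bij_betw_same_card)
qed

text \<open>Double counting of pairs of a set and one of its elements: the exponent-zero case of
  \<open>card_pointed_subsets\<close>.\<close>

lemma Suc_mult_num_sum_subsets:
  assumes fin: "finite (carrier G)"
  shows "Suc k * num_sum_subsets G (Suc k) a = card (marked_subsets G 1 k a)"
proof -
  let ?Q = "{(x, X). x \<in> X \<and> X \<subseteq> carrier G \<and> finite X \<and> card X = Suc k \<and>
           x [^] (0::nat) \<otimes> finprod G (\<lambda>x. x) X = a}"
  have fp: "finprod G (\<lambda>x. x) X \<in> carrier G" if "X \<subseteq> carrier G" for X
    using that by (intro finprod_closed) auto
  have "Suc k * num_sum_subsets G (Suc k) a = (\<Sum>X\<in>sum_subsets G (Suc k) a. card X)"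
    by (simp add: num_sum_subsets_def sum_subsets_def)
  also have "\<dots> = card (SIGMA X:sum_subsets G (Suc k) a. X)"
    using finite_sum_subsets[OF fin] by (subst card_SigmaI) (auto simp: sum_subsets_def)
  also have "\<dots> = card ?Q"
    by (rule bij_betw_same_card[of prod.swap], rule bij_betw_byWitness[where f' = prod.swap])
       (auto simp: sum_subsets_def fp)
  also have "\<dots> = card (marked_subsets G 1 k a)"
    using card_pointed_subsets[of k 0 a] by simp
  finally show ?thesis .
qed

text \<open>The pairs on the left are split by whether \<open>x\<close> lies in \<open>X\<close>;
  those with \<open>x\<close> inside are handled by \<open>card_pointed_subsets\<close>. This is the
  single step that telescopes into Newton's identity.\<close>

lemma sum_num_sum_subsets_shift:
  assumes fin: "finite (carrier G)" and a: "a \<in> carrier G"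
  shows "(\<Sum>x\<in>carrier G. num_sum_subsets G k (a \<otimes> inv (x [^] j))) =
         card (marked_subsets G j k a) +
         (case k of 0 \<Rightarrow> 0 | Suc i \<Rightarrow> card (marked_subsets G (Suc j) i a))"
proof -
  let ?Q = "{(x, X). x \<in> X \<and> X \<subseteq> carrier G \<and> finite X \<and> card X = k \<and>
           x [^] j \<otimes> finprod G (\<lambda>x. x) X = a}"
  have fp: "finprod G (\<lambda>x. x) X \<in> carrier G" if "X \<subseteq> carrier G" for X
    using that by (intro finprod_closed) auto
  have iff: "finprod G (\<lambda>x. x) X = a \<otimes> inv (x [^] j) \<longleftrightarrow> x [^] j \<otimes> finprod G (\<lambda>x. x) X = a"
    if "x \<in> carrier G" "X \<subseteq> carrier G" for x X
    using that a fp[of X] inv_solve_right[of "finprod G (\<lambda>x. x) X" a "x [^] j"]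
    by (auto simp: m_comm)
  have finQ: "finite ?Q"
    by (rule finite_subset[of _ "carrier G \<times> Pow (carrier G)"]) (use fin in auto)
  have "(\<Sum>x\<in>carrier G. num_sum_subsets G k (a \<otimes> inv (x [^] j))) =
        card (SIGMA x:carrier G. sum_subsets G k (a \<otimes> inv (x [^] j)))"
    unfolding num_sum_subsets_def
    using fin finite_sum_subsets[OF fin] by (subst card_SigmaI) auto
  also have "(SIGMA x:carrier G. sum_subsets G k (a \<otimes> inv (x [^] j))) =
             marked_subsets G j k a \<union> ?Q"
    using iff by (auto simp: sum_subsets_def marked_subsets_def)
  also have "card \<dots> = card (marked_subsets G j k a) + card ?Q"
    using finQ finite_marked_subsets[OF fin]
    by (intro card_Un_disjoint) (auto simp: marked_subsets_def)
  also have "card ?Q = (case k of 0 \<Rightarrow> 0 | Suc i \<Rightarrow> card (marked_subsets G (Suc j) i a))"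
  proof (cases k)
    case 0
    hence "?Q = {}" by auto
    thus ?thesis using 0 by (metis (no_types, lifting) card.empty old.nat.simps(4))
  next
    case (Suc i)
    thus ?thesis using card_pointed_subsets[of i j a] by simp
  qed
  finally show ?thesis .
qed

lemma sum_num_sum_subsets:
  assumes fin: "finite (carrier G)"
  shows "(\<Sum>a\<in>carrier G. num_sum_subsets G k a) = order G choose k"
proof -
  have fp: "finprod G (\<lambda>x. x) X \<in> carrier G" if "X \<subseteq> carrier G" for X
    using that by (intro finprod_closed) auto
  have "(\<Sum>a\<in>carrier G. num_sum_subsets G k a) = card (\<Union>a\<in>carrier G. sum_subsets G k a)"
    unfolding num_sum_subsets_def using fin finite_sum_subsets[OF fin]
    by (intro card_UN_disjoint [symmetric]) (auto simp: sum_subsets_def)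
  also have "(\<Union>a\<in>carrier G. sum_subsets G k a) = {X. X \<subseteq> carrier G \<and> card X = k}"
    using fin fp by (auto simp: sum_subsets_def dest: finite_subset)
  also have "card \<dots> = order G choose k"
    using n_subsets[OF fin] by (simp add: order_def)
  finally show ?thesis .
qed

text \<open>For exponent 1 the argument runs through the whole group once, so this term is the same
  for every \<open>a\<close> and cancels in differences.\<close>

lemma sum_num_sum_subsets_translate:
  assumes fin: "finite (carrier G)" and a: "a \<in> carrier G"
  shows "(\<Sum>x\<in>carrier G. num_sum_subsets G k (a \<otimes> inv (x [^] (1::nat)))) = order G choose k"
proof -
  have "bij_betw (\<lambda>x. a \<otimes> inv x) (carrier G) (carrier G)"
  proof (rule bij_betw_byWitness[where f' = "\<lambda>x. a \<otimes> inv x"])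
    have "a \<otimes> inv (a \<otimes> inv x) = x" if "x \<in> carrier G" for x
      using a that by (simp add: inv_mult m_assoc [symmetric])
    thus "\<forall>x\<in>carrier G. a \<otimes> inv (a \<otimes> inv x) = x"
      "\<forall>x\<in>carrier G. a \<otimes> inv (a \<otimes> inv x) = x" by simp_all
  qed (use a in auto)
  from sum.reindex_bij_betw[OF this, of "num_sum_subsets G k"] show ?thesis
    using sum_num_sum_subsets[OF fin] by simp
qed

end

section \<open>The oscillation recurrence\<close>

text \<open>The two-term form arises by subtracting consecutive instances of the recurrence with the
  full sum, which \<open>spread_sum\<close> recovers. For natural \<open>n\<close> the value is the
  sum of \<open>n\<close> to the number of cycles over all derangements of \<open>k\<close> points,
  divided by \<open>k!\<close>.\<close>

fun spread :: "real \<Rightarrow> nat \<Rightarrow> real" where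
  "spread n 0 = 1"
| "spread n (Suc 0) = 0"
| "spread n (Suc (Suc k)) = (real (Suc k) * spread n (Suc k) + n * spread n k) / real (Suc (Suc k))"

lemma spread_nonneg: "n \<ge> 0 \<Longrightarrow> spread n k \<ge> 0"
  by (induction n k rule: spread.induct) auto

lemma spread_rec:
  "real (Suc (Suc k)) * spread n (Suc (Suc k)) = real (Suc k) * spread n (Suc k) + n * spread n k"
  by simp

lemma spread_sum: "real (Suc (Suc k)) * spread n (Suc (Suc k)) = n * (\<Sum>i\<le>k. spread n i)"
proof (induction k)
  case (Suc k)
  show ?case unfolding spread_rec[of "Suc k"] Suc by (simp add: algebra_simps)
qed simp

lemma (in comm_group) num_sum_subsets_diff_le:
  assumes fin: "finite (carrier G)"
  shows "a \<in> carrier G \<Longrightarrow> b \<in> carrier G \<Longrightarrow>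
    \<bar>real (num_sum_subsets G k a) - real (num_sum_subsets G k b)\<bar> \<le> spread (order G) k"
proof (induction k arbitrary: a b rule: less_induct)
  case (less k)
  let ?f = "\<lambda>k a. real (num_sum_subsets G k a)"
  let ?g = "\<lambda>j k a. real (card (marked_subsets G j k a))"
  have P: "\<bar>(\<Sum>x\<in>carrier G. ?f i (c \<otimes> inv (x [^] j))) -
           (\<Sum>x\<in>carrier G. ?f i (d \<otimes> inv (x [^] j)))\<bar> \<le> order G * spread (order G) i"
    if "i < k" "c \<in> carrier G" "d \<in> carrier G" for i c d and j :: nat
  proof -
    have "\<bar>\<Sum>x\<in>carrier G. ?f i (c \<otimes> inv (x [^] j)) - ?f i (d \<otimes> inv (x [^] j))\<bar>
        \<le> (\<Sum>x\<in>carrier G. spread (order G) i)"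
      by (rule order.trans[OF sum_abs]) (intro sum_mono less.IH m_closed inv_closed nat_pow_closed that)
    thus ?thesis by (simp add: sum_subtractf order_def)
  qed
  have S: "(\<Sum>x\<in>carrier G. ?f i (c \<otimes> inv (x [^] j))) =
      ?g j i c + (case i of 0 \<Rightarrow> 0 | Suc i \<Rightarrow> ?g (Suc j) i c)" if "c \<in> carrier G" for i c and j :: nat
    using arg_cong[OF sum_num_sum_subsets_shift[OF fin that, of i j], of real]
    by (cases i) simp_all
  \<comment> \<open>Each use of \<open>S\<close> lowers \<open>i\<close> and raises
    \<open>j\<close>, adding one term to the triangle inequality. The bound is free of
    \<open>j\<close>, so \<open>j\<close> stays arbitrary in the induction.\<close>
  have g: "\<bar>?g j i c - ?g j i d\<bar> \<le> order G * (\<Sum>l\<le>i. spread (order G) l)"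
    if "i < k" "c \<in> carrier G" "d \<in> carrier G" for i j c d
    using that
  proof (induction i arbitrary: j)
    case 0
    thus ?case using P[of 0 c d j] S[of c 0 j] S[of d 0 j] by simp
  next
    case (Suc i)
    have "\<bar>?g (Suc j) i c - ?g (Suc j) i d\<bar> \<le> order G * (\<Sum>l\<le>i. spread (order G) l)"
      using Suc by simp
    moreover have "\<bar>?g j (Suc i) c + ?g (Suc j) i c - (?g j (Suc i) d + ?g (Suc j) i d)\<bar>
        \<le> order G * spread (order G) (Suc i)"
      using P[of "Suc i" c d j] S[of c "Suc i" j] S[of d "Suc i" j] Suc.prems by simp
    ultimately have "\<bar>?g j (Suc i) c - ?g j (Suc i) d\<bar>
        \<le> order G * (\<Sum>l\<le>i. spread (order G) l) + order G * spread (order G) (Suc i)"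
      by linarith
    thus ?case by (simp add: distrib_left)
  qed
  have T: "(\<Sum>x\<in>carrier G. ?f i (c \<otimes> inv (x [^] (1::nat)))) = real (order G choose i)"
    if "c \<in> carrier G" for i c
    using arg_cong[OF sum_num_sum_subsets_translate[OF fin that, of i], of real] by simp
  have M: "real (Suc i) * ?f (Suc i) c = ?g 1 i c" for i c
    using arg_cong[OF Suc_mult_num_sum_subsets[OF fin, of i c], of real]
    by (simp only: of_nat_mult)
  consider "k = 0" | "k = 1" | i where "k = Suc (Suc i)"
    by (metis One_nat_def not0_implies_Suc)
  thus ?case
  proof cases
    case 1
    have "sum_subsets G 0 c \<subseteq> {{}}" for c by (auto simp: sum_subsets_def)
    hence "num_sum_subsets G 0 c \<le> card {{} :: 'a set}" for c
      unfolding num_sum_subsets_def by (intro card_mono) auto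
    hence "num_sum_subsets G 0 c \<le> 1" for c by simp
    hence "?f 0 a \<le> 1" "?f 0 b \<le> 1" by simp_all
    thus ?thesis unfolding 1 by (simp add: abs_le_iff)
  next
    case 2
    have "?f 1 c = 1" if "c \<in> carrier G" for c
      using M[of 0 c] T[OF that, of 0] S[OF that, of 0 1] by simp
    thus ?thesis using 2 less.prems by simp
  next
    case (3 i)
    \<comment> \<open>For exponent 1 the left side of \<open>S\<close> is constant by
      \<open>T\<close>, so the oscillation of \<open>?f k\<close> comes from \<open>?g 2 i\<close>
      alone. Hence the sum of earlier bounds stops at \<open>k - 2\<close>.\<close>
    have "real k * (?f k c) = real (order G choose Suc i) - ?g 2 i c" if "c \<in> carrier G" for c
      using M[of "Suc i" c] T[OF that, of "Suc i"] S[OF that, of "Suc i" 1] 3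
      by (simp add: numeral_2_eq_2)
    hence "real k * (?f k a - ?f k b) = ?g 2 i b - ?g 2 i a"
      using less.prems by (simp add: right_diff_distrib)
    hence "real k * \<bar>?f k a - ?f k b\<bar> = \<bar>?g 2 i b - ?g 2 i a\<bar>"
      by (metis abs_mult abs_of_nat)
    also have "\<dots> \<le> order G * (\<Sum>l\<le>i. spread (order G) l)"
      using less.prems 3 by (intro g) auto
    also have "\<dots> = real k * spread (order G) k"
      unfolding 3 spread_sum ..
    finally show ?thesis using 3 by (subst (asm) mult_le_cancel_left_pos) auto
  qed
qed

section \<open>Generating function bound and the range of large \<open>h\<close>\<close>

text \<open>A nonnegative coefficient times \<open>y ^ h\<close> is at most the generating function
  at \<open>y\<close>. Working with the truncation \<open>S\<close> at degree \<open>h\<close>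
  avoids any question of convergence.\<close>

lemma spread_power_le:
  fixes y :: real
  assumes y: "0 \<le> y" "y < 1"
  shows "spread n h * y ^ h * ((1 - y) ^ n * exp (n * y)) \<le> 1"
proof -
  define S where "S = (\<lambda>y::real. \<Sum>k\<le>h. spread n k * y ^ k)"
  define S' where "S' = (\<lambda>(y::real) m. \<Sum>k\<le>m. spread n k * (real k * y ^ (k - 1)))"
  \<comment> \<open>The differential equation \<open>(1 - y) E' = n y E\<close> of the full series,
    truncated; the extra term on the left is a nonnegative remainder and is dropped in
    \<open>le\<close>.\<close>
  have S': "(1 - y) * S' y (Suc k) + real (Suc k) * spread n (Suc k) * y ^ Suc k =
      n * y * (\<Sum>i<k. spread n i * y ^ i)" for y :: real and k
  proof (induction k)
    case 0
    show ?case by (simp add: S'_def)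
  next
    case (Suc k)
    have "S' y (Suc (Suc k)) = S' y (Suc k) + real (Suc (Suc k)) * spread n (Suc (Suc k)) * y ^ Suc k"
      by (simp add: S'_def mult_ac del: spread.simps of_nat_Suc)
    hence "(1 - y) * S' y (Suc (Suc k)) + real (Suc (Suc k)) * spread n (Suc (Suc k)) * y ^ Suc (Suc k)
      = (1 - y) * S' y (Suc k) + real (Suc (Suc k)) * spread n (Suc (Suc k)) * y ^ Suc k"
      by (simp add: algebra_simps del: spread.simps of_nat_Suc)
    also have "\<dots> = n * y * (\<Sum>i<k. spread n i * y ^ i) + n * spread n k * y ^ Suc k"
      unfolding spread_rec using Suc by (simp add: algebra_simps del: spread.simps of_nat_Suc)
    also have "\<dots> = n * y * (\<Sum>i<Suc k. spread n i * y ^ i)"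
      by (simp add: algebra_simps)
    finally show ?case .
  qed
  have le: "(1 - y) * S' y h \<le> n * y * S y" if "0 \<le> y" for y :: real
  proof (cases h)
    case 0
    thus ?thesis using that by (simp add: S'_def S_def)
  next
    case (Suc k)
    have "(1 - y) * S' y h \<le> n * y * (\<Sum>i<k. spread n i * y ^ i)"
    proof -
      have "0 \<le> real (Suc k) * spread n (Suc k) * y ^ Suc k"
        using that by (intro mult_nonneg_nonneg spread_nonneg) auto
      thus ?thesis using S'[of y k] unfolding Suc by linarith
    qed
    also have "\<dots> \<le> n * y * S y"
      unfolding S_def Suc using that
      by (intro mult_left_mono sum_mono2) (auto simp: spread_nonneg)
    finally show ?thesis .
  qed
  \<comment> \<open>\<open>le\<close> is a differential inequality for the truncated generating function \<open>S\<close>; the weight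
    turns it into monotonicity.\<close>
  let ?F = "\<lambda>y::real. S y * ((1 - y) ^ n * exp (n * y))"
  have "?F y \<le> ?F 0"
  proof (rule DERIV_nonpos_imp_nonincreasing[OF y(1)])
    fix t assume t: "0 \<le> t" "t \<le> y"
    have dS: "(S has_real_derivative S' t h) (at t)"
      unfolding S_def S'_def by (auto intro!: derivative_eq_intros sum.cong)
    have "(?F has_real_derivative
        (S' t h * ((1 - t) ^ n * exp (n * t)) + S t * (exp (n * t) * n * (1 - t) ^ n
           - real n * (1 - t) ^ (n - 1) * exp (n * t)))) (at t)"
      by (auto intro!: derivative_eq_intros dS simp: algebra_simps)
    moreover have "S' t h * ((1 - t) ^ n * exp (n * t)) + S t * (exp (n * t) * n * (1 - t) ^ n
           - real n * (1 - t) ^ (n - 1) * exp (n * t)) \<le> 0"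
    proof (cases n)
      case 0
      thus ?thesis using le[of t] t y by (auto simp: mult_le_0_iff)
    next
      case (Suc m)
      have "S' t h * ((1 - t) ^ n * exp (n * t)) + S t * (exp (n * t) * n * (1 - t) ^ n
           - real n * (1 - t) ^ (n - 1) * exp (n * t))
         = exp (n * t) * (1 - t) ^ m * ((1 - t) * S' t h - n * t * S t)"
        unfolding Suc by (simp add: algebra_simps)
      also have "\<dots> \<le> 0"
        using le[of t] t y by (intro mult_nonneg_nonpos) auto
      finally show ?thesis .
    qed
    ultimately show "\<exists>z. (?F has_real_derivative z) (at t) \<and> z \<le> 0" by blast
  qed
  moreover have "S 0 = 1"
    unfolding S_def by (simp add: power_0_left if_distrib[of "\<lambda>x. _ * x"] sum.delta cong: if_cong)
  moreover have "spread n h * y ^ h \<le> S y"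
    unfolding S_def using y by (intro member_le_sum) (auto simp: spread_nonneg)
  hence "spread n h * y ^ h * ((1 - y) ^ n * exp (n * y)) \<le> ?F y"
    using y by (intro mult_right_mono) auto
  ultimately show ?thesis by simp
qed

text \<open>The mean of the distribution is the integer \<open>h\<close>, which is therefore a mode;
  the largest of \<open>n + 1\<close> probabilities with sum 1 is at least
  \<open>1 / (n + 1)\<close>.\<close>

lemma binomial_mode:
  fixes n h :: nat
  assumes h: "0 < h" "h < n"
  defines "y \<equiv> real h / real n"
  shows "1 \<le> real (Suc n) * (real (n choose h) * y ^ h * (1 - y) ^ (n - h))"
proof -
  define b where "b = (\<lambda>k. real (n choose k) * y ^ k * (1 - y) ^ (n - k))"
  have y: "0 < y" "y < 1" using h by (auto simp: y_def)
  \<comment> \<open>The ratio of consecutive probabilities with denominators cleared; comparing the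
    two coefficients decides where \<open>b\<close> rises and where it falls.\<close>
  have step: "real (Suc k) * (1 - y) * b (Suc k) = real (n - k) * y * b k" if "k < n" for k
  proof -
    have "real (Suc k) * real (n choose Suc k) = real (n - k) * real (n choose k)"
      using binomial_absorb_comp[of n k] binomial_absorption[of k n]
      by (metis of_nat_mult)
    moreover have "(1 - y) ^ (n - k) = (1 - y) * (1 - y) ^ (n - Suc k)"
      using that by (metis Suc_diff_Suc power_Suc)
    ultimately show ?thesis unfolding b_def
      by (simp add: mult_ac del: of_nat_Suc)
  qed
  have b0: "b k \<ge> 0" for k using y by (auto simp: b_def)
  have yn: "y * n = h" using h by (simp add: y_def)
  have up: "b k \<le> b (Suc k)" if "Suc k \<le> h" for k
  proof -
    have k: "k < n" using that h by simp
    have "real (Suc k) * (1 - y) \<le> real (n - k) * y"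
    proof -
      have "real (Suc k) \<le> real h" using that by simp
      thus ?thesis using yn k y by (simp add: of_nat_diff algebra_simps)
    qed
    hence "real (Suc k) * (1 - y) * b k \<le> real (Suc k) * (1 - y) * b (Suc k)"
      unfolding step[OF k] by (rule mult_right_mono[OF _ b0])
    thus ?thesis using y by (subst (asm) mult_le_cancel_left_pos) auto
  qed
  have down: "b (Suc k) \<le> b k" if "h \<le> k" "k < n" for k
  proof -
    have "real (n - k) * y \<le> real (Suc k) * (1 - y)"
    proof -
      have "real h \<le> real k" using that by simp
      thus ?thesis using yn that y by (simp add: of_nat_diff algebra_simps)
    qed
    hence "real (Suc k) * (1 - y) * b (Suc k) \<le> real (Suc k) * (1 - y) * b k"
      unfolding step[OF that(2)] by (rule mult_right_mono[OF _ b0])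
    thus ?thesis using y by (subst (asm) mult_le_cancel_left_pos) auto
  qed
  have "b k \<le> b h" if "k \<le> n" for k
  proof (cases "k \<le> h")
    case True
    thus ?thesis
    proof (induction k rule: inc_induct)
      case (step m)
      thus ?case using up[of m] by simp
    qed simp
  next
    case False
    hence "h \<le> k" by simp
    thus ?thesis using that
    proof (induction k rule: dec_induct)
      case (step m)
      thus ?case using down[of m] by simp
    qed simp
  qed
  hence "(\<Sum>k\<le>n. b k) \<le> (\<Sum>k\<le>n. b h)" by (intro sum_mono) auto
  moreover have "(\<Sum>k\<le>n. b k) = 1"
    using binomial_ring[of y "1 - y" n] by (simp add: b_def)
  ultimately show ?thesis by (simp add: b_def)
qed

lemma spread_le_large:
  assumes n: "n \<ge> 50" and h: "0 < h" "h \<le> n div 2 + 1"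
  shows "spread n h * (6 / 5) ^ h \<le> real (Suc n) * real (n choose h)"
proof -
  define y where "y = real h / real n"
  have hn: "h < n" using n h by linarith
  have y: "0 < y" "y < 1" using hn h by (auto simp: y_def)
  have "2 * h \<le> n + 2" using h by linarith
  hence "2 * real h \<le> real n + 2" by linarith
  \<comment> \<open>The bound is \<open>1/2 + 1/n\<close> at \<open>n = 50\<close>. Together with
    \<open>e\<close> at least \<open>5/2\<close> it yields the base
    \<open>(12/25) (5/2) = 6/5\<close>.\<close>
  hence "y \<le> 26 / 50" using n by (simp add: y_def field_simps)
  hence y2: "1 - y \<ge> 12 / 25" by simp
  have "exp (1::real) \<ge> 5 / 2" using exp_lower_Taylor_quadratic[of 1] by simp
  hence "(12 / 25) * (5 / 2) \<le> (1 - y) * exp 1" using y2 by (intro mult_mono) auto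
  hence base: "6 / 5 \<le> (1 - y) * exp 1" by simp
  \<comment> \<open>The common factor of the generating function bound and the binomial probability;
    it is cancelled at the end.\<close>
  define c where "c = y ^ h * (1 - y) ^ (n - h)"
  have c: "c > 0" using y by (simp add: c_def)
  have "exp (real n * y) = exp 1 ^ h"
    using hn by (simp add: y_def flip: exp_of_nat_mult)
  moreover have "(1 - y) ^ n = (1 - y) ^ (n - h) * (1 - y) ^ h"
    using hn by (simp flip: power_add)
  ultimately have "c * (spread n h * ((1 - y) * exp 1) ^ h) =
      spread n h * y ^ h * ((1 - y) ^ n * exp (n * y))"
    by (simp add: c_def power_mult_distrib mult_ac)
  also have "\<dots> \<le> 1" using y by (intro spread_power_le) auto
  also have "\<dots> \<le> real (Suc n) * (real (n choose h) * y ^ h * (1 - y) ^ (n - h))"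
    unfolding y_def using h(1) hn by (rule binomial_mode)
  also have "\<dots> = c * (real (Suc n) * real (n choose h))"
    by (simp add: c_def mult_ac)
  finally have "spread n h * ((1 - y) * exp 1) ^ h \<le> real (Suc n) * real (n choose h)"
    using c by (subst (asm) mult_le_cancel_left_pos)
  moreover have "spread n h * (6 / 5) ^ h \<le> spread n h * ((1 - y) * exp 1) ^ h"
    using base by (intro mult_left_mono power_mono) (auto simp: spread_nonneg)
  ultimately show ?thesis by linarith
qed

section \<open>The range of small \<open>h\<close>\<close>

text \<open>The two-term recurrence needs the two base cases 3 and 4, where the ratio of
  \<open>n ^ 2 * spread n h\<close> to the binomial coefficient tends to 2 and 3; the constant 5
  leaves room for lower order terms from \<open>n = 50\<close> on.\<close>

lemma spread_le_small:
  assumes n: "n \<ge> 50" and h: "3 \<le> h" "4 * h \<le> n"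
  shows "real n ^ 2 * spread n h \<le> 5 * real (n choose h)"
  using h
proof (induction h rule: less_induct)
  case (less h)
  \<comment> \<open>After this substitution both base cases become polynomial inequalities whose
    difference has only positive coefficients in \<open>u\<close>.\<close>
  obtain u :: real where u: "real n = u + 50" "u \<ge> 0"
    using n by (intro that[of "real n - 50"]) auto
  have ch: "real (Suc k) * real (n choose Suc k) = (real n - real k) * real (n choose k)" if "k \<le> n" for k
    using that binomial_absorb_comp[of n k] binomial_absorption[of k n]
    by (metis of_nat_mult of_nat_diff)
  have c2: "2 * real (n choose 2) = (real n - 1) * n"
    using ch[of 1] n by (simp add: numeral_2_eq_2 del: binomial_Suc_Suc)
  have c3: "6 * real (n choose 3) = (real n - 2) * ((real n - 1) * n)"
    using ch[of 2] n unfolding c2[symmetric] by simp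
  have c4: "24 * real (n choose 4) = (real n - 3) * ((real n - 2) * ((real n - 1) * n))"
    using ch[of 3] n unfolding c3[symmetric] by simp
  consider "h = 3" | "h = 4" | "h \<ge> 5" using less.prems by linarith
  thus ?case
  proof cases
    case 1
    have "spread n 3 = n / 3" by (simp add: eval_nat_numeral)
    hence "6 * (real n ^ 2 * spread n 3) = real n ^ 2 * n * 2" by simp
    moreover have "real n ^ 2 * n * 2 \<le> 5 * ((real n - 2) * ((real n - 1) * n))"
    proof -
      have "2 * real n ^ 2 \<le> 5 * ((real n - 2) * (real n - 1))"
        unfolding u using u(2) by (simp add: power2_eq_square algebra_simps)
      from mult_right_mono[OF this of_nat_0_le_iff[of n]] show ?thesis by (simp only: mult_ac)
    qed
    ultimately show ?thesis unfolding 1 using c3 by linarith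
  next
    case 2
    have "24 * spread n 4 = 6 * real n + 3 * real n * real n"
      by (simp add: eval_nat_numeral add_divide_distrib)
    hence "24 * (real n ^ 2 * spread n 4) = real n ^ 2 * (6 * real n + 3 * real n * real n)"
      by (simp only: mult.left_commute[of 24])
    moreover have "real n ^ 2 * (6 * real n + 3 * real n * real n) \<le> 5 * ((real n - 3) * ((real n - 2) * ((real n - 1) * n)))"
    proof -
      have "real n * (6 * real n + 3 * real n * real n) \<le> 5 * ((real n - 3) * ((real n - 2) * (real n - 1)))"
        unfolding u using u(2) by (simp add: algebra_simps)
      from mult_right_mono[OF this of_nat_0_le_iff[of n]] show ?thesis
        by (simp only: power2_eq_square mult_ac)
    qed
    ultimately show ?thesis unfolding 2 using c4 by linarith
  next
    case 3
    define k where "k = h - 2"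
    have k: "h = Suc (Suc k)" "k \<ge> 3" using 3 by (auto simp: k_def)
    let ?C = "\<lambda>k. real (n choose k)"
    have IH1: "real n ^ 2 * spread n (Suc k) \<le> 5 * ?C (Suc k)"
     and IH2: "real n ^ 2 * spread n k \<le> 5 * ?C k"
      using k less.prems by (auto intro!: less.IH)
    have kn: "4 * (real k + 2) \<le> real n" using less.prems k by simp
    define p q where "p = real n - real k" and "q = real n - real k - 1"
    have e1: "real (Suc k) * ?C (Suc k) = p * ?C k"
      using ch[of k] less.prems k by (simp add: p_def)
    have e2: "real h * ?C h = q * ?C (Suc k)"
      using ch[of "Suc k"] less.prems k by (simp add: q_def algebra_simps)
    have pq: "p > 0" "q > 0" using kn by (auto simp: p_def q_def)
    \<comment> \<open>Here \<open>4 * h \<le> n\<close> enters: \<open>k + 1\<close> is at most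
      \<open>n/4\<close> while \<open>p\<close> and \<open>q\<close> are at least
      \<open>3n/4\<close>, so the claim reduces to \<open>1/2 \<le> 9/16\<close>.\<close>
    have key: "real (Suc k) * p + real n * real (Suc k) \<le> q * p"
    proof -
      have "real (Suc k) * p + real n * real (Suc k) \<le> (real n / 4) * n + real n * (real n / 4)"
        using kn by (intro add_mono mult_mono) (auto simp: p_def)
      also have "\<dots> \<le> (3 * real n / 4) * (3 * real n / 4)" by (simp add: field_simps)
      also have "\<dots> \<le> q * p"
        using kn by (intro mult_mono) (auto simp: p_def q_def)
      finally show ?thesis .
    qed
    \<comment> \<open>The factor \<open>p\<close> allows \<open>e1\<close> to turn the coefficient
      at \<open>k\<close> into the one at \<open>k + 1\<close> without division.\<close>
    have "p * (real h * (real n ^ 2 * spread n h)) =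
        p * (real (Suc k) * (real n ^ 2 * spread n (Suc k)) + n * (real n ^ 2 * spread n k))"
    proof -
      have "p * (real h * (real n ^ 2 * spread n h)) = p * real n ^ 2 * (real h * spread n h)"
        by (simp only: mult_ac)
      also have "\<dots> = p * real n ^ 2 * (real (Suc k) * spread n (Suc k) + n * spread n k)"
        unfolding k spread_rec ..
      finally show ?thesis by (simp only: distrib_left mult_ac)
    qed
    also have "\<dots> \<le> p * (real (Suc k) * (5 * ?C (Suc k)) + n * (5 * ?C k))"
      using IH1 IH2 pq by (intro mult_left_mono add_mono) auto
    also have "\<dots> = 5 * (real (Suc k) * p * ?C (Suc k) + n * (p * ?C k))"
      by (simp add: algebra_simps)
    also have "\<dots> = 5 * ((real (Suc k) * p + real n * real (Suc k)) * ?C (Suc k))"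
      unfolding e1[symmetric] by (simp add: algebra_simps)
    also have "\<dots> \<le> 5 * ((q * p) * ?C (Suc k))"
      using key by (intro mult_left_mono mult_right_mono) auto
    also have "\<dots> = p * (real h * (5 * ?C h))"
      using e2 by (simp add: algebra_simps)
    finally have "p * real h * (real n ^ 2 * spread n h) \<le> p * real h * (5 * ?C h)"
      by (simp add: mult.assoc)
    thus ?thesis using pq k by (subst (asm) mult_le_cancel_left_pos) auto
  qed
qed

section \<open>From the oscillation to the limit of the ratio\<close>

text \<open>Adding the bounds of the two ranges gives one bound that depends on \<open>n\<close>
  alone.\<close>

lemma spread_div_binomial_le:
  assumes n: "n \<ge> 50" and h: "4 \<le> h" "h \<le> n div 2 + 1"
  shows "real n * spread n h / real (n choose h) \<le>
           5 / n + real n * real (Suc n) * (5 / 6) powr (n / 4)"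
proof -
  have C: "real (n choose h) > 0" using n h by simp
  show ?thesis
  proof (cases "4 * h \<le> n")
    case True
    hence "real n ^ 2 * spread n h \<le> 5 * real (n choose h)"
      using n h by (intro spread_le_small) auto
    hence "real n * spread n h / real (n choose h) \<le> 5 / n"
      using C n by (simp add: field_simps power2_eq_square)
    thus ?thesis by (rule add_increasing2[rotated]) auto
  next
    case False
    have "spread n h \<le> real (Suc n) * real (n choose h) * (5 / 6) ^ h"
      using spread_le_large[OF n _ h(2)] h(1) by (simp add: field_simps)
    also have "(5 / 6 :: real) ^ h = (5 / 6) powr h" by (simp add: powr_realpow)
    \<comment> \<open>The base is below 1, so \<open>h > n/4\<close> makes the power
      smaller.\<close>
    also have "\<dots> \<le> (5 / 6) powr (n / 4)"
      using False by (intro powr_mono') auto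
    finally have "spread n h \<le> real (Suc n) * real (n choose h) * (5 / 6) powr (n / 4)"
      by (simp add: mult_left_mono)
    hence "real n * spread n h \<le> real n * (real (Suc n) * real (n choose h) * (5 / 6) powr (n / 4))"
      by (rule mult_left_mono) simp
    hence "real n * spread n h / real (n choose h) \<le> real n * real (Suc n) * (5 / 6) powr (n / 4)"
      using C by (simp add: pos_divide_le_eq mult_ac)
    thus ?thesis by (rule add_increasing[rotated]) simp
  qed
qed

text \<open>The maximum is at least the average, the binomial coefficient divided by the order, and
  it exceeds the minimum by at most \<open>spread\<close>.\<close>

lemma (in comm_group) Min_div_Max_num_sum_subsets_ge:
  assumes fin: "finite (carrier G)" and h: "h \<le> order G"
  shows "1 - order G * spread (order G) h / real (order G choose h) \<le>
     real (Min (num_sum_subsets G h ` carrier G)) / real (Max (num_sum_subsets G h ` carrier G))"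
proof -
  let ?f = "num_sum_subsets G h" and ?n = "order G"
  define m M where "m = Min (?f ` carrier G)" and "M = Max (?f ` carrier G)"
  have ne: "?f ` carrier G \<noteq> {}" "finite (?f ` carrier G)" using fin by auto
  obtain a where a: "a \<in> carrier G" "m = ?f a" using Min_in[OF ne(2,1)] by (auto simp: m_def)
  obtain b where b: "b \<in> carrier G" "M = ?f b" using Max_in[OF ne(2,1)] by (auto simp: M_def)
  have diff: "real M - real m \<le> spread ?n h"
    using num_sum_subsets_diff_le[OF fin a(1) b(1), of h] a b by linarith
  have "?n choose h \<le> (\<Sum>a\<in>carrier G. M)"
    unfolding sum_num_sum_subsets[OF fin, symmetric] M_def using ne by (intro sum_mono Max_ge) auto
  hence CM: "?n choose h \<le> ?n * M" by (simp add: order_def)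
  have C: "?n choose h > 0" using h by simp
  hence M: "M > 0" using CM by (cases "M = 0") auto
  have CM': "real (?n choose h) \<le> ?n * M" using CM by (metis of_nat_le_iff of_nat_mult)
  have "spread ?n h * real (?n choose h) \<le> spread ?n h * (?n * M)"
    using CM' by (intro mult_left_mono spread_nonneg) auto
  hence "spread ?n h / M \<le> ?n * spread ?n h / real (?n choose h)"
    using C M by (simp add: field_simps)
  moreover have "1 - spread ?n h / M \<le> m / M"
  proof -
    have "1 - spread ?n h / M = (M - spread ?n h) / M" using M by (simp add: diff_divide_distrib)
    also have "\<dots> \<le> m / M" using diff by (intro divide_right_mono) auto
    finally show ?thesis .
  qed
  ultimately show ?thesis unfolding m_def [symmetric] M_def [symmetric] by linarith
qed

theorem theorem1:
  fixes G :: "nat \<Rightarrow> ('a, 'b) monoid_scheme" and h :: "nat \<Rightarrow> nat"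
  assumes "\<And>n. n \<ge> 1 \<Longrightarrow> comm_group (G n) \<and> finite (carrier (G n)) \<and> order (G n) = n"
    and "\<And>n. n \<ge> 6 \<Longrightarrow> 4 \<le> h n \<and> h n \<le> n div 2 + 1"
  shows "(\<lambda>n. real (Min (num_sum_subsets (G n) (h n) ` carrier (G n))) /
              real (Max (num_sum_subsets (G n) (h n) ` carrier (G n)))) \<longlonglongrightarrow> 1"
proof (rule tendsto_sandwich)
  let ?f = "\<lambda>n. num_sum_subsets (G n) (h n) ` carrier (G n)"
  \<comment> \<open>The lower bound involves neither the groups nor \<open>h\<close>, so the
    convergence is uniform in both.\<close>
  show "(\<lambda>n. 1 - (5 / real n + real n * real (Suc n) * (5 / 6) powr (real n / 4))) \<longlonglongrightarrow> 1"
    by real_asymp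
  show "(\<lambda>n. 1) \<longlonglongrightarrow> (1::real)" by simp
  show "\<forall>\<^sub>F n in sequentially. 1 - (5 / real n + real n * real (Suc n) * (5 / 6) powr (real n / 4))
          \<le> real (Min (?f n)) / real (Max (?f n))"
    using eventually_ge_at_top[of 50]
  proof eventually_elim
    case (elim n)
    have G: "comm_group (G n)" "finite (carrier (G n))" "order (G n) = n" using assms(1)[of n] elim by auto
    have h: "4 \<le> h n" "h n \<le> n div 2 + 1" using assms(2)[of n] elim by auto
    have "h n \<le> order (G n)" using h elim G by linarith
    from comm_group.Min_div_Max_num_sum_subsets_ge[OF G(1,2) this]
    show ?case using spread_div_binomial_le[OF elim h] unfolding G(3) by linarith
  qed
  show "\<forall>\<^sub>F n in sequentially. real (Min (?f n)) / real (Max (?f n)) \<le> 1"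
    using eventually_ge_at_top[of 1]
  proof eventually_elim
    case (elim n)
    interpret comm_group "G n" using assms(1)[of n] elim by auto
    have "finite (?f n)" "?f n \<noteq> {}" using assms(1)[of n] elim by auto
    hence "Min (?f n) \<le> Max (?f n)" by (meson Max_ge Min_in)
    thus ?case by (auto simp: divide_le_eq_1)
  qed
qed

end
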